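(* Let $m\ge 2$, $s\ge 1$ and let $X_1,\dots,X_m\in\mathbb{Z}^s$ span $\mathbb{R}^s$ and satisfy $\langle X_j,\alpha\rangle>0$ for all $j$, for some $\alpha\in\mathbb{R}^s$. Let $\mathcal{J}=X_1\mathbb{N}+\dots+X_m\mathbb{N}$ and for $z\in\mathcal{J}$ let $\mathbf{m}(z)$ be the number of finite words $i_1\cdots i_n$ ($n\ge0$, $i_k\in\{1,\dots,m\}$) with $X_{i_1}+\dots+X_{i_n}=z$. Let $C_0\ge1$ be an integer. Then there exists a polynomial $Q$ with positive coefficients such that $$\frac{1}{Q(\|z\|)}\le\frac{\mathbf{m}(z)}{\mathbf{m}(z')}\le Q(\|z\|)$$ whenever $z,z'\in\mathcal{J}$ and $\|z-z'\|\le C_0$.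
   Context: $\mathbb{N}=\{0,1,2,\dots\}$, $\|\cdot\|$ is the Euclidean norm. *)

theory Defs
  imports "HOL-Analysis.Analysis" "HOL-Computational_Algebra.Polynomial"
begin

definition nat_span :: "nat \<Rightarrow> (nat \<Rightarrow> real ^ 's) \<Rightarrow> (real ^ 's) set" where
  "nat_span m X = {z. \<exists>k :: nat \<Rightarrow> nat. z = (\<Sum>j = 1..m. real (k j) *\<^sub>R X j)}"

definition words_to :: "nat \<Rightarrow> (nat \<Rightarrow> real ^ 's) \<Rightarrow> real ^ 's \<Rightarrow> nat list set" where
  "words_to m X z = {w. set w \<subseteq> {1..m} \<and> (\<Sum>i\<leftarrow>w. X i) = z}"

definition num_words :: "nat \<Rightarrow> (nat \<Rightarrow> real ^ 's) \<Rightarrow> real ^ 's \<Rightarrow> nat" where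
  "num_words m X z = card (words_to m X z)"

text \<open>Positivity of all \<^term>\<open>X j \<bullet> \<alpha>\<close> bounds the length of the words, so the cardinality
  in \<^const>\<open>num_words\<close> is that of a finite set.\<close>

lemma finite_words_to:
  fixes X :: "nat \<Rightarrow> real ^ 's"
  assumes pos: "\<And>j. j \<in> {1..m} \<Longrightarrow> X j \<bullet> \<alpha> > 0"
  shows "finite (words_to m X z)"
proof (cases "m = 0")
  case True
  then have "words_to m X z \<subseteq> {[]}" by (auto simp: words_to_def)
  then show ?thesis by (rule finite_subset) simp
next
  case False
  define d where "d = Min ((\<lambda>j. X j \<bullet> \<alpha>) ` {1..m})"
  have d: "d > 0" unfolding d_def using False pos by (subst Min_gr_iff) auto
  have dle: "d \<le> X j \<bullet> \<alpha>" if "j \<in> {1..m}" for j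
    unfolding d_def using that by (intro Min_le) auto
  have len: "real (length w) * d \<le> (\<Sum>i\<leftarrow>w. X i) \<bullet> \<alpha>" if "set w \<subseteq> {1..m}" for w
    using that
  proof (induction w)
    case (Cons a w)
    then show ?case using dle[of a] by (simp add: inner_add_left algebra_simps)
  qed simp
  have "words_to m X z \<subseteq> {w. set w \<subseteq> {1..m} \<and> length w \<le> nat \<lfloor>(z \<bullet> \<alpha>) / d\<rfloor>}"
  proof
    fix w assume w: "w \<in> words_to m X z"
    then have "real (length w) * d \<le> z \<bullet> \<alpha>" using len[of w] by (auto simp: words_to_def)
    then have "real (length w) \<le> (z \<bullet> \<alpha>) / d" using d by (simp add: field_simps)
    then have "length w \<le> nat \<lfloor>(z \<bullet> \<alpha>) / d\<rfloor>" by linarith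
    then show "w \<in> {w. set w \<subseteq> {1..m} \<and> length w \<le> nat \<lfloor>(z \<bullet> \<alpha>) / d\<rfloor>}"
      using w by (auto simp: words_to_def)
  qed
  then show ?thesis by (rule finite_subset) (intro finite_lists_length_le, simp)
qed

end

theory Submission
  imports Defs
begin

text \<open>By Dickson's lemma there are finitely many pairs of words \<open>(a, b)\<close> such that, whenever
  \<open>w\<close> is a word for \<open>z\<close> and \<open>w'\<close> one for \<open>z'\<close> with \<open>z - z' = v\<close>, some pair \<open>(a, b)\<close> of the same
  difference \<open>v\<close> has \<open>a\<close> contained in \<open>w\<close> and \<open>b\<close> contained in \<open>w'\<close> as multisets.
  Deleting the letters of \<open>a\<close> from \<open>w\<close> and prepending \<open>b\<close> then gives a word for \<open>z'\<close>, from which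
  \<open>w\<close> is recovered by dropping a bounded prefix and inserting boundedly many letters; the number
  of ways to do so is polynomial in the length of \<open>w\<close>, hence in the norm of \<open>z\<close>. Only finitely
  many integral \<open>v\<close> have norm at most \<open>C0\<close>, so the bounds are uniform.\<close>

section \<open>Dickson's lemma\<close>

text \<open>Induction on the coordinates. A finite set \<open>T\<close> that dominates on
  \<open>I\<close> also serves every \<open>s\<close> whose new coordinate exceeds the maximum of
  that coordinate over \<open>T\<close>. The other \<open>s\<close> lie in finitely many slices on
  which the new coordinate is constant, and each slice has its own finite dominating set.\<close>

lemma dickson:
  fixes f :: "'x \<Rightarrow> 'i \<Rightarrow> nat"
  assumes "finite I"
  shows "\<exists>T\<subseteq>S. finite T \<and> (\<forall>s\<in>S. \<exists>t\<in>T. \<forall>i\<in>I. f t i \<le> f s i)"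
  using assms
proof (induction I arbitrary: S rule: finite_induct)
  case empty
  show ?case
  proof (cases "S = {}")
    case False
    then obtain s where "s \<in> S" by blast
    then show ?thesis by (intro exI[of _ "{s}"]) auto
  qed auto
next
  case (insert i I)
  obtain T where T: "T \<subseteq> S" "finite T" "\<And>s. s \<in> S \<Longrightarrow> \<exists>t\<in>T. \<forall>i\<in>I. f t i \<le> f s i"
    using insert.IH[of S] by meson
  define P where "P n V \<longleftrightarrow> V \<subseteq> {s \<in> S. f s i = n} \<and> finite V \<and>
    (\<forall>s \<in> {s \<in> S. f s i = n}. \<exists>t\<in>V. \<forall>i\<in>I. f t i \<le> f s i)" for n V
  have "\<forall>n. \<exists>V. P n V" unfolding P_def using insert.IH by blast
  then obtain U where U': "\<And>n. P n (U n)" by metis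
  have U: "U n \<subseteq> {s \<in> S. f s i = n}" "finite (U n)" for n
    using U'[of n] by (simp_all add: P_def)
  have U_dom: "\<exists>t\<in>U (f s i). \<forall>i\<in>I. f t i \<le> f s i" if "s \<in> S" for s
    using U'[of "f s i"] that by (simp add: P_def)
  obtain N where N: "\<And>t. t \<in> T \<Longrightarrow> f t i \<le> N"
    using finite_nat_set_iff_bounded_le[of "(\<lambda>t. f t i) ` T"] T(2) by auto
  show ?case
  proof (intro exI[of _ "T \<union> (\<Union>n\<le>N. U n)"] conjI ballI)
    show "T \<union> (\<Union>n\<le>N. U n) \<subseteq> S" using T(1) U(1) by auto
    show "finite (T \<union> (\<Union>n\<le>N. U n))" using T(2) U(2) by auto
    fix s assume s: "s \<in> S"
    show "\<exists>t \<in> T \<union> (\<Union>n\<le>N. U n). \<forall>j \<in> insert i I. f t j \<le> f s j"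
    proof (cases "f s i \<le> N")
      case True
      obtain t where t: "t \<in> U (f s i)" "\<forall>i\<in>I. f t i \<le> f s i" using U_dom[OF s] by blast
      moreover have "f t i = f s i" using t(1) U(1) by auto
      ultimately show ?thesis using True by (intro bexI[of _ t]) auto
    next
      case False
      obtain t where t: "t \<in> T" "\<forall>i\<in>I. f t i \<le> f s i" using T(3)[OF s] by blast
      then show ?thesis using False N[of t] by (intro bexI[of _ t]) auto
    qed
  qed
qed

section \<open>Deleting letters and putting them back\<close>

definition insert_at :: "nat \<times> 'a \<Rightarrow> 'a list \<Rightarrow> 'a list" where
  "insert_at p xs = take (fst p) xs @ snd p # drop (fst p) xs"

text \<open>The letters of \<open>A\<close> are deleted one at a time, and each deletion records its
  position and letter. Positions are bounded by \<open>length w\<close>, not by the length of the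
  current word, so that all records come from one fixed finite set.\<close>

lemma ex_reinsertions:
  assumes "A \<subseteq># mset w"
  shows "\<exists>ps r. mset r = mset w - A \<and> length ps = size A \<and>
    set ps \<subseteq> {..length w} \<times> set w \<and> fold insert_at ps r = w"
  using assms
proof (induction A)
  case empty
  show ?case by (intro exI[of _ "[]"] exI[of _ w]) simp
next
  case (add x A)
  then obtain ps r where IH: "mset r = mset w - A" "length ps = size A"
    "set ps \<subseteq> {..length w} \<times> set w" "fold insert_at ps r = w"
    using subset_mset.order_trans[OF mset_subset_eq_add_right[of A "{#x#}"]] by auto
  have "x \<in># mset w - A"
    using mset_subset_eq_count[OF add.prems, of x] by (simp add: in_diff_count Suc_le_eq)
  then have "x \<in> set r" using IH(1) by (metis set_mset_mset)
  then obtain u v where r: "r = u @ x # v" by (meson split_list)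
  have "size (mset r) \<le> size (mset w)" unfolding IH(1) by (intro size_mset_mono diff_subset_eq_self)
  then have u: "length u \<le> length w" using r by simp
  have x: "x \<in> set w" using \<open>x \<in># mset w - A\<close> by (metis in_diffD set_mset_mset)
  have "mset (u @ v) = mset w - add_mset x A"
    using arg_cong[OF IH(1), of "\<lambda>M. M - {#x#}"] r by simp
  \<comment> \<open>\<open>fold\<close> consumes the list from its head, so the latest deletion is
    undone first.\<close>
  moreover have "fold insert_at ((length u, x) # ps) (u @ v) = w"
    using IH(4) r by (simp add: insert_at_def)
  ultimately show ?case using IH u x
    by (intro exI[of _ "(length u, x) # ps"] exI[of _ "u @ v"]) auto
qed

section \<open>Exchanges of bounded length\<close>

abbreviation weight :: "(nat \<Rightarrow> real ^ 's) \<Rightarrow> nat list \<Rightarrow> real ^ 's" where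
  "weight X w \<equiv> (\<Sum>i\<leftarrow>w. X i)"

lemma weight_eq_sum_mset: "weight X w = (\<Sum>i\<in>#mset w. X i)"
  by (metis mset_map sum_mset_sum_list)

text \<open>Dickson's lemma is applied to pairs of words through their letter counts:
  \<open>Inl j\<close> counts \<open>j\<close> in the first word, \<open>Inr j\<close> in the
  second. Dominating pairs are taken from \<open>S\<close> itself, so they have the same difference
  \<open>v\<close>.\<close>

lemma bounded_exchange:
  fixes X :: "nat \<Rightarrow> real ^ 's"
  shows "\<exists>B. \<forall>w w'. set w \<subseteq> {1..m} \<and> set w' \<subseteq> {1..m} \<and> weight X w - weight X w' = v \<longrightarrow>
    (\<exists>a b. length a \<le> B \<and> length b \<le> B \<and> mset a \<subseteq># mset w \<and> set b \<subseteq> {1..m} \<and>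
      weight X a - weight X b = v)"
proof -
  define S where "S = {(w, w'). set w \<subseteq> {1..m} \<and> set w' \<subseteq> {1..m} \<and> weight X w - weight X w' = v}"
  define f :: "nat list \<times> nat list \<Rightarrow> nat + nat \<Rightarrow> nat"
    where "f = (\<lambda>(w, w'). case_sum (count (mset w)) (count (mset w')))"
  obtain T where T: "T \<subseteq> S" "finite T"
    and dom: "\<And>s. s \<in> S \<Longrightarrow> \<exists>t\<in>T. \<forall>i \<in> {1..m} <+> {1..m}. f t i \<le> f s i"
    using dickson[of "{1..m} <+> {1..m}" S f] by auto
  \<comment> \<open>A sum over \<open>T\<close> bounds every single length and needs no case
    distinction for empty \<open>T\<close>.\<close>
  define B where "B = (\<Sum>(a, b)\<in>T. length a + length b)"
  show ?thesis
  proof (intro exI[of _ B] allI impI)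
    fix w w' assume "set w \<subseteq> {1..m} \<and> set w' \<subseteq> {1..m} \<and> weight X w - weight X w' = v"
    then have "(w, w') \<in> S" by (simp add: S_def)
    then obtain a b where ab: "(a, b) \<in> T"
      and le: "\<And>i. i \<in> {1..m} <+> {1..m} \<Longrightarrow> f (a, b) i \<le> f (w, w') i"
      using dom by (metis surj_pair)
    have S: "set a \<subseteq> {1..m}" "set b \<subseteq> {1..m}" "weight X a - weight X b = v"
      using ab T(1) by (auto simp: S_def)
    have "count (mset a) j \<le> count (mset w) j" for j
    proof (cases "j \<in> {1..m}")
      case True
      then show ?thesis using le[OF InlI, of j] by (simp add: f_def)
    next
      case False
      then have "j \<notin># mset a" using S(1) by auto
      then show ?thesis by (metis count_eq_zero_iff le0)
    qed
    then have "mset a \<subseteq># mset w" by (simp add: subseteq_mset_def)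
    moreover have "(case (a, b) of (a, b) \<Rightarrow> length a + length b) \<le> B"
      unfolding B_def using ab T(2) by (intro member_le_sum) auto
    ultimately show "\<exists>a b. length a \<le> B \<and> length b \<le> B \<and> mset a \<subseteq># mset w \<and> set b \<subseteq> {1..m} \<and>
      weight X a - weight X b = v"
      using S by (intro exI[of _ a] exI[of _ b]) auto
  qed
qed

text \<open>An integral vector is recovered from the floors of its entries, and the norm confines
  these to a finite range.\<close>

lemma finite_bounded_integral_vectors:
  "finite {v :: real ^ 's. (\<forall>i. v $ i \<in> \<int>) \<and> norm v \<le> C}"
proof (rule finite_subset)
  let ?F = "UNIV \<rightarrow>\<^sub>E {-\<lceil>C\<rceil>..\<lceil>C\<rceil>} :: ('s \<Rightarrow> int) set"
  show "finite ((\<lambda>g. \<chi> i. of_int (g i)) ` ?F :: (real ^ 's) set)"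
    by (intro finite_imageI finite_PiE) auto
  show "{v :: real ^ 's. (\<forall>i. v $ i \<in> \<int>) \<and> norm v \<le> C} \<subseteq> (\<lambda>g. \<chi> i. of_int (g i)) ` ?F"
  proof
    fix v :: "real ^ 's" assume v: "v \<in> {v. (\<forall>i. v $ i \<in> \<int>) \<and> norm v \<le> C}"
    then have "\<bar>v $ i\<bar> \<le> C" for i using component_le_norm_cart[of v i] by simp
    then have "\<lfloor>v $ i\<rfloor> \<in> {-\<lceil>C\<rceil>..\<lceil>C\<rceil>}" for i
      using v by (simp add: abs_le_iff le_floor_iff floor_le_iff) (smt (verit) le_of_int_ceiling)
    then show "v \<in> (\<lambda>g. \<chi> i. of_int (g i)) ` ?F"
      using v by (intro image_eqI[of _ _ "\<lambda>i. \<lfloor>v $ i\<rfloor>"]) (auto simp: vec_eq_iff elim: Ints_cases)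
  qed
qed

lemma weight_integral:
  assumes "\<forall>j \<in> {1..m}. \<forall>i. X j $ i \<in> \<int>" "set w \<subseteq> {1..m}"
  shows "weight X w $ i \<in> \<int>"
  using assms(2) by (induction w) (use assms(1) in auto)

lemma uniform_bounded_exchange:
  fixes X :: "nat \<Rightarrow> real ^ 's"
  assumes "\<forall>j \<in> {1..m}. \<forall>i. X j $ i \<in> \<int>"
  obtains B where "\<And>w w'. set w \<subseteq> {1..m} \<Longrightarrow> set w' \<subseteq> {1..m} \<Longrightarrow>
      norm (weight X w - weight X w') \<le> C \<Longrightarrow>
      \<exists>a b. length a \<le> B \<and> length b \<le> B \<and> mset a \<subseteq># mset w \<and> set b \<subseteq> {1..m} \<and>
        weight X a - weight X b = weight X w - weight X w'"
proof -
  let ?V = "{v :: real ^ 's. (\<forall>i. v $ i \<in> \<int>) \<and> norm v \<le> C}"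
  obtain B where B: "\<And>v w w'. set w \<subseteq> {1..m} \<Longrightarrow> set w' \<subseteq> {1..m} \<Longrightarrow>
      weight X w - weight X w' = v \<Longrightarrow>
      \<exists>a b. length a \<le> B v \<and> length b \<le> B v \<and> mset a \<subseteq># mset w \<and> set b \<subseteq> {1..m} \<and>
        weight X a - weight X b = v"
    using bounded_exchange[of m X] by metis
  show ?thesis
  \<comment> \<open>The bound for a single \<open>v\<close> is at most the sum over the finite set
    of admissible differences.\<close>
  proof (rule that[of "\<Sum>v\<in>?V. B v"])
    fix w w' assume w: "set w \<subseteq> {1..m}" "set w' \<subseteq> {1..m}" "norm (weight X w - weight X w') \<le> C"
    define v where "v = weight X w - weight X w'"
    have "v \<in> ?V" using w weight_integral[OF assms w(1)] weight_integral[OF assms w(2)]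
      by (auto simp: v_def)
    then have "B v \<le> (\<Sum>v\<in>?V. B v)"
      using finite_bounded_integral_vectors by (intro member_le_sum) auto
    then show "\<exists>a b. length a \<le> (\<Sum>v\<in>?V. B v) \<and> length b \<le> (\<Sum>v\<in>?V. B v) \<and>
        mset a \<subseteq># mset w \<and> set b \<subseteq> {1..m} \<and> weight X a - weight X b = weight X w - weight X w'"
      using B[OF w(1,2) v_def[symmetric]] le_trans unfolding v_def by blast
  qed
qed

section \<open>Existence and length of words\<close>

text \<open>Concatenating \<open>k j\<close> copies of each letter \<open>j\<close> gives a word.
  This makes the counts positive and supplies a partner word for the exchange.\<close>

lemma words_to_nonempty:
  assumes "z \<in> nat_span m X"
  shows "words_to m X z \<noteq> {}"
proof -
  obtain k :: "nat \<Rightarrow> nat" where z: "z = (\<Sum>j = 1..m. real (k j) *\<^sub>R X j)"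
    using assms by (auto simp: nat_span_def)
  have "\<exists>w. set w \<subseteq> {1..n} \<and> weight X w = (\<Sum>j = 1..n. real (k j) *\<^sub>R X j)" for n
  proof (induction n)
    case (Suc n)
    then obtain w where "set w \<subseteq> {1..n}" "weight X w = (\<Sum>j = 1..n. real (k j) *\<^sub>R X j)" by blast
    then show ?case
      by (intro exI[of _ "w @ replicate (k (Suc n)) (Suc n)"])
        (auto simp: sum_list_replicate scaleR_conv_of_real sum_list_triv)
  qed simp
  then show ?thesis using z by (fastforce simp: words_to_def)
qed

text \<open>Each letter adds at least some fixed \<open>d > 0\<close> to the inner product with
  \<alpha>, which Cauchy-Schwarz bounds by the norm. Having \<open>K \<ge> 1\<close> later allows
  \<open>L + 1\<close> to be absorbed into \<open>K * (1 + norm z)\<close>.\<close>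

lemma length_le_of_weight:
  fixes X :: "nat \<Rightarrow> real ^ 's"
  assumes "\<forall>j \<in> {1..m}. X j \<bullet> \<alpha> > 0"
  obtains K where "K \<ge> 1" "\<And>w. set w \<subseteq> {1..m} \<Longrightarrow> real (length w) \<le> K * norm (weight X w)"
proof -
  have "\<exists>d>0. \<forall>j\<in>{1..m}. d \<le> X j \<bullet> \<alpha>"
    using assms
    \<comment> \<open>Inserting 1 keeps the minimum meaningful when \<open>m = 0\<close>.\<close>
    by (intro exI[of _ "Min (insert 1 ((\<lambda>j. X j \<bullet> \<alpha>) ` {1..m}))"])
      (auto simp del: Min_insert intro!: Min_le)
  then obtain d where d: "d > 0" "\<And>j. j \<in> {1..m} \<Longrightarrow> d \<le> X j \<bullet> \<alpha>" by blast
  show ?thesis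
  proof (rule that[of "max 1 (norm \<alpha> / d)"])
    fix w assume w: "set w \<subseteq> {1..m}"
    then have "real (length w) * d \<le> weight X w \<bullet> \<alpha>"
    proof (induction w)
      case (Cons a w)
      then show ?case using d(2)[of a] by (simp add: inner_add_left algebra_simps)
    qed simp
    also have "\<dots> \<le> norm (weight X w) * norm \<alpha>" by (rule norm_cauchy_schwarz)
    finally have "real (length w) \<le> norm \<alpha> / d * norm (weight X w)"
      using d(1) by (simp add: field_simps)
    also have "\<dots> \<le> max 1 (norm \<alpha> / d) * norm (weight X w)"
      by (intro mult_right_mono) auto
    finally show "real (length w) \<le> max 1 (norm \<alpha> / d) * norm (weight X w)" .
  qed simp
qed

section \<open>Counting the codes\<close>

lemma card_lists_length_le_bound:
  assumes "finite A" "A \<noteq> {}"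
  shows "card {xs. set xs \<subseteq> A \<and> length xs \<le> n} \<le> (n + 1) * card A ^ n"
proof -
  have "card A \<ge> 1" using assms by (simp add: Suc_le_eq card_gt_0_iff)
  have "card {xs. set xs \<subseteq> A \<and> length xs \<le> n} = (\<Sum>i\<le>n. card A ^ i)"
    by (rule card_lists_length_le[OF assms(1)])
  also have "\<dots> \<le> (\<Sum>i\<le>n. card A ^ n)"
    using \<open>card A \<ge> 1\<close> by (intro sum_mono power_increasing) auto
  finally show ?thesis by simp
qed

text \<open>Each word for \<open>z\<close> has a code consisting of a word for \<open>z'\<close>, a
  prefix length and a reinsertion list. Decoding covers all words for \<open>z\<close>, so the
  number of codes bounds their number. For fixed \<open>B\<close> and \<open>m\<close> the factor is
  polynomial in \<open>L\<close>.\<close>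

lemma num_words_le_of_exchange:
  fixes X :: "nat \<Rightarrow> real ^ 's"
  assumes m: "m \<ge> 1" and fin: "finite (words_to m X z')"
    and len: "\<And>w. w \<in> words_to m X z \<Longrightarrow> length w \<le> L"
    and exch: "\<And>w. w \<in> words_to m X z \<Longrightarrow>
      \<exists>a b. length a \<le> B \<and> length b \<le> B \<and> mset a \<subseteq># mset w \<and> set b \<subseteq> {1..m} \<and>
        weight X a - weight X b = z - z'"
  shows "num_words m X z \<le> num_words m X z' * ((B + 1) * ((B + 1) * ((L + 1) * m) ^ B))"
proof -
  let ?P = "{ps. set ps \<subseteq> {..L} \<times> {1..m} \<and> length ps \<le> B}"
  let ?D = "words_to m X z' \<times> {..B} \<times> ?P"
  \<comment> \<open>The prefix \<open>b\<close> can be discarded once its length is known; what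
    remains is \<open>r\<close>, into which the deleted letters are reinserted.\<close>
  define decode where "decode = (\<lambda>(w', n, ps). fold insert_at ps (drop n w') :: nat list)"
  have P: "finite ?P" by (intro finite_lists_length_le) auto
  have "words_to m X z \<subseteq> decode ` ?D"
  proof
    fix w assume w: "w \<in> words_to m X z"
    obtain a b where ab: "length a \<le> B" "length b \<le> B" "mset a \<subseteq># mset w" "set b \<subseteq> {1..m}"
      "weight X a - weight X b = z - z'"
      using exch[OF w] by blast
    obtain ps r where r: "mset r = mset w - mset a" "length ps = size (mset a)"
      "set ps \<subseteq> {..length w} \<times> set w" "fold insert_at ps r = w"
      using ex_reinsertions[OF ab(3)] by blast
    have mw: "mset w = mset r + mset a" using r(1) ab(3) by simp
    have "weight X w = weight X r + weight X a"
      unfolding weight_eq_sum_mset mw by simp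
    then have "weight X r = z - weight X a" using w by (auto simp: words_to_def eq_diff_eq)
    moreover have "weight X b = weight X a - (z - z')" using ab(5) by (simp add: algebra_simps)
    ultimately have "weight X (b @ r) = z'" by simp
    moreover have "set r \<subseteq> set w" by (metis mw set_mset_mset set_mset_union sup_ge1)
    ultimately have "b @ r \<in> words_to m X z'" using ab(4) w by (auto simp: words_to_def)
    moreover have "ps \<in> ?P" using r(2,3) ab(1) w len[OF w] by (fastforce simp: words_to_def)
    moreover have "decode (b @ r, length b, ps) = w" using r(4) by (simp add: decode_def)
    ultimately show "w \<in> decode ` ?D" using ab(2) by (metis (no_types, lifting) SigmaI atMost_iff image_eqI)
  qed
  then have "num_words m X z \<le> card ?D"
    unfolding num_words_def using fin P by (intro surj_card_le) auto
  also have "\<dots> = num_words m X z' * ((B + 1) * card ?P)"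
    by (simp add: num_words_def card_cartesian_product)
  also have "\<dots> \<le> num_words m X z' * ((B + 1) * ((B + 1) * ((L + 1) * m) ^ B))"
    using card_lists_length_le_bound[of "{..L} \<times> {1..m}" B] m by (intro mult_left_mono) simp_all
  finally show ?thesis .
qed

lemma num_words_ratio_bound:
  fixes X :: "nat \<Rightarrow> real ^ 's"
  assumes m: "m \<ge> 1" and int: "\<forall>j \<in> {1..m}. \<forall>i. X j $ i \<in> \<int>"
    and pos: "\<forall>j \<in> {1..m}. X j \<bullet> \<alpha> > 0"
  obtains D B where "D > 0" "\<And>z z'. z \<in> nat_span m X \<Longrightarrow> z' \<in> nat_span m X \<Longrightarrow> norm (z - z') \<le> C \<Longrightarrow>
    real (num_words m X z) \<le> real (num_words m X z') * (D * (1 + norm z) ^ B)"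
proof -
  obtain K where K: "K \<ge> 1" "\<And>w. set w \<subseteq> {1..m} \<Longrightarrow> real (length w) \<le> K * norm (weight X w)"
    using length_le_of_weight[OF pos] by blast
  obtain B where B: "\<And>w w'. set w \<subseteq> {1..m} \<Longrightarrow> set w' \<subseteq> {1..m} \<Longrightarrow>
      norm (weight X w - weight X w') \<le> C \<Longrightarrow>
      \<exists>a b. length a \<le> B \<and> length b \<le> B \<and> mset a \<subseteq># mset w \<and> set b \<subseteq> {1..m} \<and>
        weight X a - weight X b = weight X w - weight X w'"
    using uniform_bounded_exchange[OF int] by blast
  \<comment> \<open>This collects the factors that stay constant once \<open>L + 1\<close> is
    replaced by \<open>K * (1 + norm z)\<close>.\<close>
  define D where "D = (real B + 1) * (real B + 1) * (K * real m) ^ B"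
  show ?thesis
  proof (rule that[of D B])
    show "D > 0" using K m by (simp add: D_def)
    fix z z' assume z: "z \<in> nat_span m X" "z' \<in> nat_span m X" "norm (z - z') \<le> C"
    define L where "L = nat \<lfloor>K * norm z\<rfloor>"
    \<comment> \<open>A single word for \<open>z'\<close> serves as partner for all words for
      \<open>z\<close>.\<close>
    obtain w' where w': "set w' \<subseteq> {1..m}" "weight X w' = z'"
      using words_to_nonempty[OF z(2)] by (auto simp: words_to_def)
    have "num_words m X z \<le> num_words m X z' * ((B + 1) * ((B + 1) * ((L + 1) * m) ^ B))"
    proof (rule num_words_le_of_exchange[OF m])
      show "finite (words_to m X z')" using pos by (intro finite_words_to[of m X \<alpha>]) auto
      fix w assume w: "w \<in> words_to m X z"
      then show "length w \<le> L" using K(2)[of w] unfolding L_def words_to_def by simp linarith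
      show "\<exists>a b. length a \<le> B \<and> length b \<le> B \<and> mset a \<subseteq># mset w \<and> set b \<subseteq> {1..m} \<and>
          weight X a - weight X b = z - z'"
        using B[of w w'] w w' z(3) by (simp add: words_to_def)
    qed
    then have "real (num_words m X z) \<le>
        real (num_words m X z' * ((B + 1) * ((B + 1) * ((L + 1) * m) ^ B)))"
      by (rule of_nat_mono)
    also have "\<dots> = real (num_words m X z') *
        ((real B + 1) * (real B + 1) * ((real L + 1) * real m) ^ B)"
      by (simp add: algebra_simps)
    also have "\<dots> \<le> real (num_words m X z') *
        ((real B + 1) * (real B + 1) * ((K * (1 + norm z)) * real m) ^ B)"
    proof -
      have "real L \<le> K * norm z" unfolding L_def using K(1) by simp
      then have "real L + 1 \<le> K * (1 + norm z)" using K(1) by (simp add: algebra_simps)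
      then show ?thesis by (intro mult_left_mono power_mono mult_right_mono) auto
    qed
    also have "\<dots> = real (num_words m X z') * (D * (1 + norm z) ^ B)"
      by (simp add: D_def power_mult_distrib mult_ac)
    finally show "real (num_words m X z) \<le> real (num_words m X z') * (D * (1 + norm z) ^ B)" .
  qed
qed

section \<open>The polynomial and the two-sided bound\<close>

theorem theorem3p3:
  fixes m :: nat and X :: "nat \<Rightarrow> real ^ 's" and C0 :: int
  assumes "m \<ge> 2"
    and "\<forall>j \<in> {1..m}. \<forall>i. X j $ i \<in> \<int>"
    and "span (X ` {1..m}) = UNIV"
    and "\<exists>\<alpha> :: real ^ 's. \<forall>j \<in> {1..m}. X j \<bullet> \<alpha> > 0"
    and "C0 \<ge> 1"
  shows "\<exists>Q :: real poly. (\<forall>i \<le> degree Q. coeff Q i > 0) \<and>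
    (\<forall>z \<in> nat_span m X. \<forall>z' \<in> nat_span m X. norm (z - z') \<le> of_int C0 \<longrightarrow>
       1 / poly Q (norm z) \<le> real (num_words m X z) / real (num_words m X z') \<and>
       real (num_words m X z) / real (num_words m X z') \<le> poly Q (norm z))"
proof -
  \<comment> \<open>Chosen so that
    \<open>1 + norm z' \<le> norm z + c \<le> c * (1 + norm z)\<close>, which turns a bound in
    \<open>norm z'\<close> into one in \<open>norm z\<close>.\<close>
  define c where "c = 1 + real_of_int C0"
  have c: "c \<ge> 1" using assms(5) by (simp add: c_def)
  obtain \<alpha> where \<alpha>: "\<forall>j \<in> {1..m}. X j \<bullet> \<alpha> > 0" using assms(4) by blast
  have m: "m \<ge> 1" using assms(1) by simp
  obtain D B where D: "D > 0" and bound: "\<And>z z'. z \<in> nat_span m X \<Longrightarrow> z' \<in> nat_span m X \<Longrightarrow>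
      norm (z - z') \<le> of_int C0 \<Longrightarrow>
      real (num_words m X z) \<le> real (num_words m X z') * (D * (1 + norm z) ^ B)"
    using num_words_ratio_bound[OF m assms(2) \<alpha>] by blast
  define Q where "Q = smult (D * c ^ B) ([:1, 1:] ^ B)"
  have Dc: "D * c ^ B > 0" using D c by simp
  have Q: "poly Q x = D * (c * (1 + x)) ^ B" for x
    by (simp add: Q_def power_mult_distrib)
  have num_pos: "real (num_words m X z) > 0" if "z \<in> nat_span m X" for z
    using words_to_nonempty[OF that] finite_words_to[of m X \<alpha> z] \<alpha>
    by (simp add: num_words_def card_gt_0_iff)
  \<comment> \<open>The coefficients are \<open>D * c ^ B\<close> times the binomial coefficients
    \<open>B choose i\<close>, positive for all \<open>i \<le> B\<close>.\<close>
  have coeffs: "coeff Q i > 0" if "i \<le> degree Q" for i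
  proof -
    have "degree Q \<le> B"
      using degree_smult_le[of "D * c ^ B" "[:1, 1:] ^ B"] degree_power_le[of "[:1, 1 :: real:]" B]
      by (simp add: Q_def)
    then have "coeff ([:1, 1 :: real:] ^ B) i = real (B choose i)" "i \<le> B"
      using that by (simp_all add: coeff_linear_poly_power)
    then show ?thesis using Dc by (simp add: Q_def)
  qed
  have ratio: "1 / poly Q (norm z) \<le> real (num_words m X z) / real (num_words m X z') \<and>
      real (num_words m X z) / real (num_words m X z') \<le> poly Q (norm z)"
    if z: "z \<in> nat_span m X" "z' \<in> nat_span m X" "norm (z - z') \<le> of_int C0" for z z'
  proof -
    have Q_pos: "poly Q (norm z) > 0" using D c by (simp add: Q add_pos_nonneg)
    have mono: "D * (1 + x) ^ B \<le> poly Q (norm z)" if "0 \<le> x" "1 + x \<le> c * (1 + norm z)" for x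
      using that D by (auto simp: Q intro!: mult_left_mono power_mono)
    have "1 * (1 + norm z) \<le> c * (1 + norm z)" using c by (intro mult_right_mono) auto
    then have 1: "D * (1 + norm z) ^ B \<le> poly Q (norm z)" by (intro mono) auto
    have "norm z' \<le> norm z + C0" using z(3) norm_triangle_ineq2[of z' z] by (simp add: norm_minus_commute)
    moreover have "norm z + c \<le> c * (1 + norm z)" using c mult_right_mono[of 1 c "norm z"]
      by (simp add: algebra_simps)
    ultimately have 2: "D * (1 + norm z') ^ B \<le> poly Q (norm z)"
      by (intro mono) (auto simp: c_def)
    have "real (num_words m X z) \<le> real (num_words m X z') * poly Q (norm z)"
      using bound[OF z] mult_left_mono[OF 1, of "real (num_words m X z')"] by simp
    \<comment> \<open>The same estimate with \<open>z\<close> and \<open>z'\<close> interchanged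
      yields the lower bound for the ratio.\<close>
    moreover have "real (num_words m X z') \<le> real (num_words m X z) * poly Q (norm z)"
      using bound[OF z(2,1)] z(3) mult_left_mono[OF 2, of "real (num_words m X z)"]
      by (simp add: norm_minus_commute)
    ultimately show ?thesis
      using Q_pos num_pos[OF z(1)] num_pos[OF z(2)] by (simp add: field_simps)
  qed
  show ?thesis using coeffs ratio by blast
qed

end
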